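(* Let $X$ be a smooth projective curve over $\mathbb{C}$ and let $(V,q)$ be a quadratic bundle of rank $3$ on $X$ (a conic bundle). For $\tau<1/16$, stability of $(V,q)$ with respect to $\tau$ in the sense of Gómez–Sols implies the $\delta$-(semi)-stability condition for $(V,q)$ (with $\delta=1$) when $q$ is generically non-degenerate.
   Context: For $\delta=1$, the $\delta$-(semi)-stability condition on $(V,q)$ means that the underlying vector bundle $V$ is (semi)-stable; the notation "(semi)-stable" covers both the stable and the semi-stable versions. Gómez–Sols stability. Let $(E,Q)$ be a conic bundle: a rank $3$ vector bundle $E$ on $X$ with a quadratic form $Q:\mathrm{Sym}^2E\to\mathcal{O}_X$. Two subbundles $E_1\subset E_2\subset E$ give a critical filtration if $\mathrm{rank}(E_1)=1$, $\mathrm{rank}(E_2)=2$, $Q|_{E_1E_2}=0$ and $Q|_{E_1E}\ne0\ne Q|_{E_2E}$. For a positive rational number $\tau$, $(E,Q)$ is (semi)-stable with respect to $\tau$ if: (ss.1) for every proper subbundle $E'$ of $E$, $\dfrac{\deg(E')-c_Q(E')\tau}{\mathrm{rank}(E')}\le\dfrac{\deg(E)-2\tau}{3}$, where $c_Q(E')=2$ if $Q(E',E')\neq0$, else $c_Q(E')=1$ if $Q(E',E)\ne0$, and $c_Q(E')=0$ otherwise; (ss.2) for every critical filtration $E_1\subset E_2\subset E$, $\deg(E_1)+\deg(E_2)\le\deg(E)$. Stability means that these hold with strict inequalities.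
   Formalization: The conclusion is semi-stability of V, also when (V,q) is Gómez–Sols stable: the stable version fails, e.g. for the orthogonal sum of three pairwise non-isomorphic line bundles with trivial squares. *)

theory Defs
  imports "HOL-Analysis.Analysis"
begin

section \<open>Smooth projective curves over the complex numbers\<close>

text \<open>
  Varieties are taken in the classical sense (closed points only). A point of the projective space
  on \<^typ>\<open>complex^'n\<close> is a line through the origin, so its dimension is one less than the
  cardinality of \<^typ>\<open>'n\<close>. Since the ground field is infinite, forms (homogeneous polynomials)
  can be identified with the functions they define.
\<close>

type_synonym 'n point = "(complex^'n) set"

definition proj_space :: "'n::finite point set" where
  "proj_space = {vec.span {v} | v. v \<noteq> 0}"

definition form :: "nat \<Rightarrow> (complex^'n::finite \<Rightarrow> complex) \<Rightarrow> bool" where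
  "form d f \<longleftrightarrow> (\<exists>c :: ('n \<Rightarrow> nat) \<Rightarrow> complex.
     f = (\<lambda>v. \<Sum>m | (\<Sum>i\<in>UNIV. m i) = d. c m * (\<Prod>i\<in>UNIV. (v $ i) ^ m i)))"

definition zclosed :: "'n::finite point set \<Rightarrow> bool" where
  "zclosed Z \<longleftrightarrow> (\<exists>F. (\<forall>f\<in>F. \<exists>d. form d f) \<and>
     Z = {p \<in> proj_space. \<forall>f\<in>F. \<forall>v\<in>p. f v = 0})"

definition zopen :: "'n::finite point set \<Rightarrow> 'n point set \<Rightarrow> bool" where
  "zopen X U \<longleftrightarrow> (\<exists>Z. zclosed Z \<and> U = X - Z)"

definition zirreducible :: "'n::finite point set \<Rightarrow> bool" where
  "zirreducible X \<longleftrightarrow> X \<noteq> {} \<and>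
     (\<forall>Y Z. zclosed Y \<and> zclosed Z \<and> X \<subseteq> Y \<union> Z \<longrightarrow> X \<subseteq> Y \<or> X \<subseteq> Z)"

text \<open>
  The Zariski tangent space, at a nonzero vector \<open>v\<close>, of the affine cone over \<open>X\<close>. It is cut out by
  the differentials of all forms in the vanishing ideal of \<open>X\<close>, and its dimension exceeds that of
  the tangent space of \<open>X\<close> at the line spanned by \<open>v\<close> by one.
\<close>

definition cone_tangent_space :: "'n::finite point set \<Rightarrow> complex^'n \<Rightarrow> (complex^'n) set" where
  "cone_tangent_space X v = {w. \<forall>d f. form d f \<and> (\<forall>p\<in>X. \<forall>u\<in>p. f u = 0) \<longrightarrow>
     deriv (\<lambda>t. f (v + t *s w)) 0 = 0}"

text \<open>
  A variety has dimension 1 and is smooth exactly if all its Zariski tangent spaces have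
  dimension 1, i.e. those of its cone (away from the origin) have dimension 2.
\<close>

definition smooth_projective_curve :: "'n::finite point set \<Rightarrow> bool" where
  "smooth_projective_curve X \<longleftrightarrow> zclosed X \<and> zirreducible X \<and>
     (\<forall>p\<in>X. \<forall>v\<in>p. v \<noteq> 0 \<longrightarrow> vec.dim (cone_tangent_space X v) = 2)"

definition regular_on :: "'n::finite point set \<Rightarrow> 'n point set \<Rightarrow> ('n point \<Rightarrow> complex) \<Rightarrow> bool" where
  "regular_on X U f \<longleftrightarrow> (\<forall>p\<in>U. \<exists>W d g h. zopen X W \<and> p \<in> W \<and> W \<subseteq> U \<and> form d g \<and> form d h \<and>
     (\<forall>y\<in>W. \<forall>v\<in>y. v \<noteq> 0 \<longrightarrow> h v \<noteq> 0 \<and> f y = g v / h v))"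

text \<open>A uniformizer at \<open>x\<close>: a generator of the maximal ideal of the local ring at \<open>x\<close>.\<close>

definition uniformizer_on ::
  "'n::finite point set \<Rightarrow> 'n point \<Rightarrow> 'n point set \<Rightarrow> ('n point \<Rightarrow> complex) \<Rightarrow> bool" where
  "uniformizer_on X x N t \<longleftrightarrow> zopen X N \<and> x \<in> N \<and> regular_on X N t \<and> t x = 0 \<and>
     (\<forall>W f. zopen X W \<and> x \<in> W \<and> regular_on X W f \<and> f x = 0 \<longrightarrow>
       (\<exists>W' g. zopen X W' \<and> x \<in> W' \<and> W' \<subseteq> N \<inter> W \<and> regular_on X W' g \<and>
         (\<forall>y\<in>W'. f y = g y * t y)))"

text \<open>
  The order at \<open>x\<close> of a nonzero rational function \<open>f\<close>; the value of \<open>f\<close> at \<open>x\<close> itself, where it may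
  have a pole, is irrelevant.
\<close>

definition has_order ::
  "'n::finite point set \<Rightarrow> 'n point \<Rightarrow> ('n point \<Rightarrow> complex) \<Rightarrow> int \<Rightarrow> bool" where
  "has_order X x f n \<longleftrightarrow> (\<exists>N t u. uniformizer_on X x N t \<and> regular_on X N u \<and>
     (\<forall>y\<in>N. u y \<noteq> 0) \<and> (\<forall>y\<in>N - {x}. f y = u y * t y powi n))"


section \<open>Vector bundles\<close>

text \<open>
  A bundle consists of its fibres, realised as subspaces of one arbitrary complex vector space with
  scalar multiplication \<open>fscale\<close>, and of its sheaf of sections. The ambient space carries no
  geometric information: how the fibres vary algebraically is recorded by the sections alone. Sections over \<open>U\<close> are functions on all points, of
  which only the values on \<open>U\<close> matter, so that restriction of sections is the identity.
\<close>

record ('n, 'v) vbundle =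
  fibre :: "'n point \<Rightarrow> 'v set"
  fscale :: "complex \<Rightarrow> 'v \<Rightarrow> 'v"
  sections :: "'n point set \<Rightarrow> ('n point \<Rightarrow> 'v) set"

text \<open>
  A frame of rank \<open>r\<close> over \<open>U\<close> is a basis of every fibre that trivialises the sheaf of sections:
  the sections are exactly the combinations of the frame with regular coefficients.
\<close>

definition frame ::
  "'n::finite point set \<Rightarrow> ('n, 'v::ab_group_add) vbundle \<Rightarrow> nat \<Rightarrow> 'n point set \<Rightarrow>
   (nat \<Rightarrow> 'n point \<Rightarrow> 'v) \<Rightarrow> bool" where
  "frame X E r U e \<longleftrightarrow>
     (\<forall>y\<in>U. inj_on (\<lambda>i. e i y) {..<r} \<and>
        \<not> module.dependent (fscale E) ((\<lambda>i. e i y) ` {..<r}) \<and>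
        module.span (fscale E) ((\<lambda>i. e i y) ` {..<r}) = fibre E y) \<and>
     (\<forall>W s. zopen X W \<and> W \<subseteq> U \<longrightarrow>
        (s \<in> sections E W \<longleftrightarrow>
          (\<exists>a. (\<forall>i<r. regular_on X W (a i)) \<and>
               (\<forall>y\<in>W. s y = (\<Sum>i<r. fscale E (a i y) (e i y))))))"

definition vector_bundle ::
  "'n::finite point set \<Rightarrow> nat \<Rightarrow> ('n, 'v::ab_group_add) vbundle \<Rightarrow> bool" where
  "vector_bundle X r E \<longleftrightarrow> vector_space (fscale E) \<and>
     (\<forall>U s. zopen X U \<longrightarrow>
        (s \<in> sections E U \<longleftrightarrow>
          (\<forall>x\<in>U. \<exists>W. zopen X W \<and> x \<in> W \<and> W \<subseteq> U \<and> s \<in> sections E W))) \<and>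
     (\<forall>x\<in>X. \<exists>U e. zopen X U \<and> x \<in> U \<and> frame X E r U e)"

definition restrict_bundle ::
  "('n, 'v) vbundle \<Rightarrow> ('n point \<Rightarrow> 'v set) \<Rightarrow> ('n, 'v) vbundle" where
  "restrict_bundle E F =
     E\<lparr>fibre := F, sections := (\<lambda>U. {s \<in> sections E U. \<forall>y\<in>U. s y \<in> F y})\<rparr>"

text \<open>
  A subbundle is given by its family of fibres. Its local frames are pointwise independent in \<open>E\<close>,
  hence extend locally to frames of \<open>E\<close>: these are the locally free subsheaves with locally free
  quotient, not arbitrary locally free subsheaves.
\<close>

definition subbundle ::
  "'n::finite point set \<Rightarrow> ('n, 'v::ab_group_add) vbundle \<Rightarrow> nat \<Rightarrow> ('n point \<Rightarrow> 'v set) \<Rightarrow> bool" where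
  "subbundle X E k F \<longleftrightarrow> (\<forall>x\<in>X. F x \<subseteq> fibre E x) \<and> vector_bundle X k (restrict_bundle E F)"

text \<open>
  A frame \<open>s\<close> over a nonempty open \<open>U\<close> gives the rational section \<open>s 0 \<and> \<dots> \<and> s (r - 1)\<close> of the
  determinant line bundle. Its order at a point \<open>x\<close> is the order of the determinant that expresses
  \<open>s\<close> in a frame around \<open>x\<close>; the degree of the bundle is the degree of the divisor of such a
  rational section, which does not depend on the section.
\<close>

definition frame_order ::
  "'n::finite point set \<Rightarrow> ('n, 'v::ab_group_add) vbundle \<Rightarrow> nat \<Rightarrow> 'n point set \<Rightarrow>
   (nat \<Rightarrow> 'n point \<Rightarrow> 'v) \<Rightarrow> 'n point \<Rightarrow> int \<Rightarrow> bool" where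
  "frame_order X E r U s x n \<longleftrightarrow> (\<exists>W e a. zopen X W \<and> x \<in> W \<and> frame X E r W e \<and>
     (\<forall>y\<in>U \<inter> W. \<forall>j<r. s j y = (\<Sum>i<r. fscale E (a i j y) (e i y))) \<and>
     has_order X x
       (\<lambda>y. \<Sum>\<pi> | \<pi> permutes {..<r}. of_int (sign \<pi>) * (\<Prod>i<r. a i (\<pi> i) y)) n)"

definition vb_degree :: "'n::finite point set \<Rightarrow> ('n, 'v::ab_group_add) vbundle \<Rightarrow> int" where
  "vb_degree X E = (THE d. \<exists>r U s m. zopen X U \<and> U \<noteq> {} \<and> frame X E r U s \<and>
     (\<forall>x\<in>X. frame_order X E r U s x (m x)) \<and> d = (\<Sum>x | x \<in> X \<and> m x \<noteq> 0. m x))"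

abbreviation sub_degree ::
  "'n::finite point set \<Rightarrow> ('n, 'v::ab_group_add) vbundle \<Rightarrow> ('n point \<Rightarrow> 'v set) \<Rightarrow> int" where
  "sub_degree X E F \<equiv> vb_degree X (restrict_bundle E F)"

text \<open>This is \<open>\<delta>\<close>-semistability of a quadratic bundle for \<open>\<delta> = 1\<close>.\<close>

definition semistable ::
  "'n::finite point set \<Rightarrow> nat \<Rightarrow> ('n, 'v::ab_group_add) vbundle \<Rightarrow> bool" where
  "semistable X r E \<longleftrightarrow> (\<forall>k F. subbundle X E k F \<and> 0 < k \<and> k < r \<longrightarrow>
     (of_int (sub_degree X E F) / of_nat k :: rat) \<le> of_int (vb_degree X E) / of_nat r)"


section \<open>Quadratic bundles\<close>

text \<open>
  A morphism from the symmetric square of \<open>E\<close> to the structure sheaf, as a symmetric bilinear form on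
  every fibre that maps pairs of sections to regular functions.
\<close>

type_synonym ('n, 'v) bilin = "'n point \<Rightarrow> 'v \<Rightarrow> 'v \<Rightarrow> complex"

definition quadratic_form ::
  "'n::finite point set \<Rightarrow> ('n, 'v::ab_group_add) vbundle \<Rightarrow> ('n, 'v) bilin \<Rightarrow> bool" where
  "quadratic_form X E q \<longleftrightarrow>
     (\<forall>x\<in>X. \<forall>u\<in>fibre E x. \<forall>v\<in>fibre E x. \<forall>w\<in>fibre E x. \<forall>c.
        q x u v = q x v u \<and> q x (u + v) w = q x u w + q x v w \<and> q x (fscale E c u) v = c * q x u v) \<and>
     (\<forall>U s t. zopen X U \<and> s \<in> sections E U \<and> t \<in> sections E U \<longrightarrow>
        regular_on X U (\<lambda>x. q x (s x) (t x)))"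

definition quadratic_bundle ::
  "'n::finite point set \<Rightarrow> nat \<Rightarrow> ('n, 'v::ab_group_add) vbundle \<Rightarrow> ('n, 'v) bilin \<Rightarrow> bool" where
  "quadratic_bundle X r E q \<longleftrightarrow> vector_bundle X r E \<and> quadratic_form X E q"

definition generically_nondegenerate ::
  "'n::finite point set \<Rightarrow> ('n, 'v::ab_group_add) vbundle \<Rightarrow> ('n, 'v) bilin \<Rightarrow> bool" where
  "generically_nondegenerate X E q \<longleftrightarrow> (\<exists>U. zopen X U \<and> U \<noteq> {} \<and>
     (\<forall>x\<in>U. \<forall>u\<in>fibre E x. (\<forall>v\<in>fibre E x. q x u v = 0) \<longrightarrow> u = 0))"

definition vanishes_on ::
  "'n point set \<Rightarrow> ('n, 'v) bilin \<Rightarrow> ('n point \<Rightarrow> 'v set) \<Rightarrow> ('n point \<Rightarrow> 'v set) \<Rightarrow> bool" where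
  "vanishes_on X q F G \<longleftrightarrow> (\<forall>x\<in>X. \<forall>u\<in>F x. \<forall>v\<in>G x. q x u v = 0)"


section \<open>Stability of conic bundles in the sense of Gomez and Sols\<close>

definition c_index ::
  "'n point set \<Rightarrow> ('n, 'v) vbundle \<Rightarrow> ('n, 'v) bilin \<Rightarrow> ('n point \<Rightarrow> 'v set) \<Rightarrow> nat" where
  "c_index X E q F = (if \<not> vanishes_on X q F F then 2
     else if \<not> vanishes_on X q F (fibre E) then 1 else 0)"

definition critical_filtration ::
  "'n::finite point set \<Rightarrow> ('n, 'v::ab_group_add) vbundle \<Rightarrow> ('n, 'v) bilin \<Rightarrow>
   ('n point \<Rightarrow> 'v set) \<Rightarrow> ('n point \<Rightarrow> 'v set) \<Rightarrow> bool" where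
  "critical_filtration X E q F G \<longleftrightarrow> subbundle X E 1 F \<and> subbundle X E 2 G \<and> (\<forall>x\<in>X. F x \<subseteq> G x) \<and>
     vanishes_on X q F G \<and> \<not> vanishes_on X q F (fibre E) \<and> \<not> vanishes_on X q G (fibre E)"

definition gs_semistable ::
  "'n::finite point set \<Rightarrow> ('n, 'v::ab_group_add) vbundle \<Rightarrow> ('n, 'v) bilin \<Rightarrow> rat \<Rightarrow> bool" where
  "gs_semistable X E q \<tau> \<longleftrightarrow>
     (\<forall>k F. subbundle X E k F \<and> 0 < k \<and> k < 3 \<longrightarrow>
        (of_int (sub_degree X E F) - of_nat (c_index X E q F) * \<tau>) / of_nat k
          \<le> (of_int (vb_degree X E) - 2 * \<tau>) / 3) \<and>
     (\<forall>F G. critical_filtration X E q F G \<longrightarrow>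
        sub_degree X E F + sub_degree X E G \<le> vb_degree X E)"

text \<open>
  Stability, which has strict inequalities throughout, still only implies slope semistability: if
  \<open>L\<^sub>1, L\<^sub>2, L\<^sub>3\<close> are pairwise non-isomorphic line bundles with trivial squares, the orthogonal sum of the
  \<open>L\<^sub>i\<close> with their squaring maps is stable for every \<open>\<tau>\<close>, but its underlying bundle is strictly
  semistable.
\<close>

definition gs_stable ::
  "'n::finite point set \<Rightarrow> ('n, 'v::ab_group_add) vbundle \<Rightarrow> ('n, 'v) bilin \<Rightarrow> rat \<Rightarrow> bool" where
  "gs_stable X E q \<tau> \<longleftrightarrow>
     (\<forall>k F. subbundle X E k F \<and> 0 < k \<and> k < 3 \<longrightarrow>
        (of_int (sub_degree X E F) - of_nat (c_index X E q F) * \<tau>) / of_nat k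
          < (of_int (vb_degree X E) - 2 * \<tau>) / 3) \<and>
     (\<forall>F G. critical_filtration X E q F G \<longrightarrow>
        sub_degree X E F + sub_degree X E G < vb_degree X E)"

end

(*
  Since c_Q is at most 2, condition (ss.1) bounds 3 deg(F) by k deg(E) + 4 tau for a subbundle F of
  rank k < 3. As 4 tau < 1 and degrees are integers, the error term can be dropped.
*)
theory Submission
  imports Defs
begin

text \<open>Gomez-Sols stability perturbs slope stability by multiples of \<open>\<tau>\<close>. For
  \<open>F\<close> of rank \<open>k\<close>, clearing denominators in (ss.1) and using c_Q(F) \<le>
  2 gives 3 deg(F) \<le> k deg(E) + (6 - 2k) \<open>\<tau>\<close>. The error is below 1, and both
  degrees are integers, so 3 deg(F) \<le> k deg(E). The arithmetic is in
  \<open>slope_le_of_perturbed_slope_le\<close>.\<close>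

lemma c_index_le_2: "c_index X E q F \<le> 2"
  by (simp add: c_index_def)

lemma slope_le_of_perturbed_slope_le:
  fixes d D :: int and c k :: nat and \<tau> :: rat
  assumes "0 < k" "k < 3" "c \<le> 2" "0 < \<tau>" "\<tau> < 1 / 4"
    and le: "(of_int d - of_nat c * \<tau>) / of_nat k \<le> (of_int D - 2 * \<tau>) / 3"
  shows "(of_int d / of_nat k :: rat) \<le> of_int D / 3"
proof -
  have "of_nat c * \<tau> \<le> 2 * \<tau>"
    using assms by (intro mult_right_mono) auto
  hence "(of_int d - 2 * \<tau>) / of_nat k \<le> (of_int d - of_nat c * \<tau>) / of_nat k"
    by (intro divide_right_mono) auto
  hence "(of_int d - 2 * \<tau>) / of_nat k \<le> (of_int D - 2 * \<tau>) / 3"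
    using le by (rule order_trans)
  moreover have "k = 1 \<or> k = 2"
    using assms by auto
  \<comment> \<open>The excess of 3d over kD is at most 4 \<open>\<tau>\<close> for k = 1 and 2
    \<open>\<tau>\<close> for k = 2; the line case is what dictates the bound 1/4. Writing both
    sides as images of integers lets the strict inequality be rounded down.\<close>
  ultimately have "(of_int (3 * d) :: rat) < of_int (int k * D + 1)"
    using \<open>0 < \<tau>\<close> \<open>\<tau> < 1 / 4\<close> by (auto simp: field_simps)
  hence "3 * d \<le> int k * D"
    by (simp only: of_int_less_iff)
  hence "(of_int (3 * d) :: rat) \<le> of_int (int k * D)"
    by (simp only: of_int_le_iff)
  thus ?thesis
    using \<open>0 < k\<close> by (simp add: field_simps)
qed

lemma gs_stable_imp_gs_semistable: "gs_stable X E q \<tau> \<Longrightarrow> gs_semistable X E q \<tau>"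
  unfolding gs_stable_def gs_semistable_def by (meson less_imp_le)

lemma gs_semistable_imp_semistable:
  assumes "gs_semistable X E q \<tau>" "0 < \<tau>" "\<tau> < 1 / 4"
  shows "semistable X 3 E"
  unfolding semistable_def
proof (intro allI impI)
  fix k F
  assume F: "subbundle X E k F \<and> 0 < k \<and> k < 3"
  with assms(1) have "(of_int (sub_degree X E F) - of_nat (c_index X E q F) * \<tau>) / of_nat k
      \<le> (of_int (vb_degree X E) - 2 * \<tau>) / 3"
    unfolding gs_semistable_def by blast
  with F assms(2,3) have "(of_int (sub_degree X E F) / of_nat k :: rat) \<le> of_int (vb_degree X E) / 3"
    by (intro slope_le_of_perturbed_slope_le[OF _ _ c_index_le_2]) auto
  thus "(of_int (sub_degree X E F) / of_nat k :: rat) \<le> of_int (vb_degree X E) / of_nat 3"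
    by simp
qed

theorem proposition10p5:
  fixes X :: "'n::finite point set"
    and V :: "('n, 'v::ab_group_add) vbundle"
    and q :: "('n, 'v) bilin"
    and \<tau> :: rat
  assumes "smooth_projective_curve X"
    and "quadratic_bundle X 3 V q"
    and "0 < \<tau>" and "\<tau> < 1 / 16"
    and "generically_nondegenerate X V q"
  shows "(gs_semistable X V q \<tau> \<longrightarrow> semistable X 3 V) \<and>
         (gs_stable X V q \<tau> \<longrightarrow> semistable X 3 V)"
proof -
  have "\<tau> < 1 / 4"
    using assms(4) by simp
  \<comment> \<open>The stable case passes through the semistable one. Rounding loses strictness: 3
    deg(F) < k deg(V) + (6 - 2k) \<open>\<tau>\<close> still allows equality of slopes.\<close>
  thus ?thesis
    using gs_semistable_imp_semistable gs_stable_imp_gs_semistable assms(3) by blast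
qed

end
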